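(* (Error behavior of recursive summation with double 6op compensation.) Let $n\ge1$, $x_1,\dots,x_n\in\mathbb D$, $\tilde s=\sum_{k=1}^n x_k$ (exact sum in $\mathbb R$). Set $s_0=e_0=0$ and for $i=1,\dots,n$ let $$(t_i,v_i)=\mathrm{add6}(s_{i-1},x_i),\qquad w_i=fl(e_{i-1}+v_i),\qquad (s_i,e_i)=\mathrm{add6}(t_i,w_i).$$ Assume nearest rounding and that no overflow happens. Then there exist real numbers $\alpha_i,\beta_i,\gamma_i$ with $|\alpha_i|,|\beta_i|,|\gamma_i|\le\epsilon$ such that, for $i=1,\dots,n$, $$t_i=(1+\alpha_i)(s_{i-1}+x_i),\quad v_i=-\alpha_i(s_{i-1}+x_i),\quad w_i=(1+\beta_i)(e_{i-1}+v_i),$$ $$s_i=(1+\gamma_i)(t_i+w_i),\quad e_i=-\gamma_i(t_i+w_i),$$ $$s_i+e_i=(1-\alpha_i\beta_i-\beta_i\gamma_{i-1}-\alpha_i\beta_i\gamma_{i-1})(s_{i-1}+e_{i-1})+(1-\alpha_i\beta_i)x_i$$ (where $\gamma_0:=0$; its value is irrelevant since $s_0+e_0=0$), and $$s_n+e_n=\sum_{k=1}^n\Big\{\prod_{i=k+1}^n(1-\alpha_i\beta_i-\beta_i\gamma_{i-1}-\alpha_i\beta_i\gamma_{i-1})\Big\}(1-\alpha_k\beta_k)x_k,$$ with the empty product equal to $1$. Let $\sigma=2\epsilon^2+\epsilon^3$ and $\tau=\epsilon^2$. If moreover $n\sigma<1$, then $$|s_n+e_n-\tilde s|\le\tau\sum_{k=1}^n|x_k|+\sum_{k=1}^n\frac{(n-k)\sigma}{1-(n-k)\sigma}|x_k|+\sum_{k=1}^n\frac{(n-k)\sigma\tau}{1-(n-k)\sigma}|x_k|$$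 $$\le\tau\sum_{k=1}^n|x_k|+\frac{(n-1)\sigma}{1-(n-1)\sigma}\sum_{k=1}^n|x_k|+\frac{(n-1)\sigma\tau}{1-(n-1)\sigma}\sum_{k=1}^n|x_k|,$$ and $$|s_n-\tilde s|\le(1+\epsilon)\Big\{\tau\sum_{k=1}^n|x_k|+\frac{(n-1)\sigma}{1-(n-1)\sigma}\sum_{k=1}^n|x_k|+\frac{(n-1)\sigma\tau}{1-(n-1)\sigma}\sum_{k=1}^n|x_k|\Big\}+\epsilon\Big|\sum_{k=1}^n x_k\Big|.$$
   Context: Dekker's floating point number system in base $2$: let $t\ge 1$ (the number of mantissa digits, not to be confused with the variables $t_i$), $E_{\min}\le E_{\max}$ be integers and $M=2^t$. Then $\mathbb D=\{x\in\mathbb R : x=m\times2^{e},\ m,e\in\mathbb Z,\ |m|<M,\ E_{\min}\le e\le E_{\max}\}$. Nearest rounding $fl:\mathbb R\to\mathbb D$ satisfies $|fl(r)-r|\le|a-r|$ for all $a\in\mathbb D$, with ties resolved by a fixed deterministic criterion. Each floating point operation is performed as if the exact real result is produced and then rounded by $fl$. Unit round-off: $\epsilon=\tfrac12\cdot2^{1-t}=2^{-t}$. "No overflow" means that for every floating point operation performed in the algorithm (including those inside $\mathrm{add6}$), the exact real result before rounding has absolute value at most $(M-1)\times2^{E_{\max}}$. The procedure $\mathrm{add6}(x,y)$ returns $(z,zz)$ computed by $z=fl(x+y)$, $w=fl(z-x)$, $z1=fl(y-w)$, $v=fl(w-z)$, $z2=fl(x+v)$, $zz=fl(z1+z2)$.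 The perturbations $\alpha_i,\beta_i,\gamma_i$ are real numbers (the symbol $\beta_i$ is unrelated to the base). *)

theory Defs
  imports Complex_Main
begin

text \<open>
  Dekker's base 2 floating point numbers with \<open>p\<close> mantissa digits, exponents between
  \<open>Emin\<close> and \<open>Emax\<close>, and no normalisation requirement on the mantissa.
\<close>

definition dekker :: "nat \<Rightarrow> int \<Rightarrow> int \<Rightarrow> real set" where
  "dekker p Emin Emax =
     {x. \<exists>m e :: int. x = of_int m * 2 powi e \<and> \<bar>m\<bar> < 2 ^ p \<and> Emin \<le> e \<and> e \<le> Emax}"

definition unit_roundoff :: "nat \<Rightarrow> real" where
  "unit_roundoff p = 1 / 2 * 2 powi (1 - int p)"

lemma unit_roundoff_eq: "unit_roundoff p = 1 / 2 ^ p"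
  by (simp add: unit_roundoff_def power_int_diff)

definition max_float :: "nat \<Rightarrow> int \<Rightarrow> real" where
  "max_float p Emax = (2 ^ p - 1) * 2 powi Emax"

text \<open>
  Ties may be resolved arbitrarily; since \<open>fl\<close> is a function of the exact real
  result, the choice is deterministic.
\<close>

definition nearest_rounding :: "real set \<Rightarrow> (real \<Rightarrow> real) \<Rightarrow> bool" where
  "nearest_rounding D fl \<longleftrightarrow> (\<forall>r. fl r \<in> D \<and> (\<forall>a\<in>D. \<bar>fl r - r\<bar> \<le> \<bar>a - r\<bar>))"

definition add6 :: "(real \<Rightarrow> real) \<Rightarrow> real \<Rightarrow> real \<Rightarrow> real \<times> real" where
  "add6 fl x y =
     (let z = fl (x + y);
          w = fl (z - x);
          z1 = fl (y - w);
          v = fl (w - z);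
          z2 = fl (x + v);
          zz = fl (z1 + z2)
      in (z, zz))"

text \<open>
  The exact result of each of the six operations of \<open>add6\<close>, before it is rounded, is
  bounded by \<open>\<Omega>\<close> in absolute value.
\<close>

definition add6_no_overflow :: "real \<Rightarrow> (real \<Rightarrow> real) \<Rightarrow> real \<Rightarrow> real \<Rightarrow> bool" where
  "add6_no_overflow \<Omega> fl x y \<longleftrightarrow>
     (let z = fl (x + y);
          w = fl (z - x);
          z1 = fl (y - w);
          v = fl (w - z);
          z2 = fl (x + v)
      in \<bar>x + y\<bar> \<le> \<Omega> \<and> \<bar>z - x\<bar> \<le> \<Omega> \<and> \<bar>y - w\<bar> \<le> \<Omega> \<and>
         \<bar>w - z\<bar> \<le> \<Omega> \<and> \<bar>x + v\<bar> \<le> \<Omega> \<and> \<bar>z1 + z2\<bar> \<le> \<Omega>)"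

end

(*
  With nearest rounding in base 2 the error of an addition is a floating point number, and
  add6 (Knuth's and Moeller's two-sum) computes it exactly, whatever the tie-breaking rule. If
  |y| <= |x| or z - x is representable, then w = z - x and all later operations are exact.
  Otherwise |x| < |y|, |x| <= |z|, and although w = fl (z - x) is inexact, y - w, w - z and the
  error of w are all representable, so z1 + z2 is again the exact error x + y - z.

  Hence s_i + e_i = t_i + w_i, the only uncompensated rounding in step i is that of w_i, and it
  acts on a quantity that is itself already O(epsilon). This turns s_i + e_i into a linear
  recurrence with factors 1 + O(epsilon^2), and (1 + sigma)^m - 1 <= m sigma / (1 - m sigma),
  from Bernoulli's inequality for (1 - sigma)^m, bounds their products.
*)

theory Submission
  imports Defs
begin

section \<open>Dyadic grids and powers of two\<close>

text \<open>Membership in Dekker's set is split into divisibility by a power of two, expressed here,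
  and a size bound; sums and differences preserve the first, and the second is checked
  separately.\<close>

definition grid :: "int \<Rightarrow> real set" where
  "grid k = range (\<lambda>m::int. of_int m * 2 powi k)"

lemma grid_mono:
  assumes "j \<le> k" "a \<in> grid k"
  shows "a \<in> grid j"
proof -
  obtain m where m: "a = of_int m * 2 powi k" using assms(2) by (auto simp: grid_def)
  have "(2::real) powi k = 2 powi (int (nat (k - j)) + j)" using assms(1) by simp
  also have "\<dots> = 2 ^ nat (k - j) * 2 powi j"
    by (subst power_int_add) (simp_all only: power_int_of_nat, simp)
  finally have "a = of_int (m * 2 ^ nat (k - j)) * 2 powi j" using m by simp
  then show ?thesis unfolding grid_def by blast
qed

lemma grid_add: "a \<in> grid k \<Longrightarrow> b \<in> grid k \<Longrightarrow> a + b \<in> grid k"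
  unfolding grid_def by (auto simp: distrib_right[symmetric] simp flip: of_int_add)

lemma grid_diff: "a \<in> grid k \<Longrightarrow> b \<in> grid k \<Longrightarrow> a - b \<in> grid k"
  unfolding grid_def by (auto simp: left_diff_distrib[symmetric] simp flip: of_int_diff)

lemma powi_in_grid: "j \<le> k \<Longrightarrow> 2 powi k \<in> grid j"
  by (rule grid_mono[of j k]) (auto simp: grid_def intro: range_eqI[of _ _ 1])

text \<open>Distinct integers differ by at least 1. This sharpens a strict bound
  \<open>a < B + 2 powi k\<close> between grid points to \<open>a \<le> B\<close>, which the
  exactness proofs need to reach the limit \<open>2 powi (int p + k)\<close>.\<close>

lemma grid_gap:
  assumes "a \<in> grid k" "b \<in> grid k" "a < b"
  shows "a + 2 powi k \<le> b"
proof -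
  obtain m n where mn: "a = of_int m * 2 powi k" "b = of_int n * 2 powi k"
    using assms by (auto simp: grid_def)
  with assms(3) have "m < n" by simp
  then have "real_of_int (m + 1) \<le> of_int n" by linarith
  then have "real_of_int (m + 1) * 2 powi k \<le> of_int n * 2 powi k"
    by (rule mult_right_mono) simp
  then show ?thesis by (simp add: mn algebra_simps)
qed

lemma powi2_le: "(a::int) \<le> b \<Longrightarrow> (2::real) powi a \<le> 2 powi b"
  by (simp add: power_int_increasing)

lemma powi2_less_iff: "(2::real) powi a < 2 powi b \<longleftrightarrow> (a::int) < b"
  by (smt (verit) powi2_le power_int_strict_increasing)

lemma powi2_pred: "(2::real) powi (k - 1) = 2 powi k / 2"
  by (simp add: power_int_diff)

lemma powi2_Suc: "(2::real) powi (k + 1) = 2 * 2 powi k"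
  by (simp add: power_int_add)

lemma ex_powi2_le_less:
  fixes r :: real
  assumes "r > 0"
  shows "\<exists>k::int. 2 powi k \<le> r \<and> r < 2 powi (k + 1)"
proof -
  have "2 powr (of_int \<lfloor>log 2 r\<rfloor>) \<le> r"
    by (metis assms le_log_iff of_int_floor_le one_less_numeral_iff semiring_norm(76))
  moreover have "r < 2 powr (of_int (\<lfloor>log 2 r\<rfloor> + 1))"
    by (metis assms floor_correct log_less_iff one_less_numeral_iff semiring_norm(76))
  ultimately have "2 powi \<lfloor>log 2 r\<rfloor> \<le> r" "r < 2 powi (\<lfloor>log 2 r\<rfloor> + 1)"
    by (simp_all only: powr_real_of_int' [of 2, simplified])
  then show ?thesis by blast
qed

section \<open>Dekker's set and nearest rounding\<close>

text \<open>Being a locale, it can be interpreted a second time with the reflected rounding, which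
  yields the negative cases.\<close>

locale dekker_rounding =
  fixes p :: nat and Emin Emax :: int and fl :: "real \<Rightarrow> real"
  assumes p: "p \<ge> 1" and E: "Emin \<le> Emax"
    and rnd: "nearest_rounding (dekker p Emin Emax) fl"
begin

abbreviation "D \<equiv> dekker p Emin Emax"
abbreviation "Om \<equiv> max_float p Emax"

lemma fl_in [simp, intro]: "fl r \<in> D"
  using rnd by (simp add: nearest_rounding_def)

lemma fl_nearest: "a \<in> D \<Longrightarrow> \<bar>fl r - r\<bar> \<le> \<bar>a - r\<bar>"
  using rnd by (simp add: nearest_rounding_def)

lemma fl_id [simp]: "a \<in> D \<Longrightarrow> fl a = a"
  using fl_nearest[of a a] by simp

text \<open>If \<open>fl r < a \<le> r\<close>, then \<open>a\<close> would be nearer to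
  \<open>r\<close> than \<open>fl r\<close>. Comparison with elements of \<open>D\<close> is the
  only form of monotonicity used.\<close>

lemma le_fl: "a \<in> D \<Longrightarrow> a \<le> r \<Longrightarrow> a \<le> fl r"
  by (cases "r \<in> D") (use fl_nearest[of a r] fl_in[of r] in \<open>force+\<close>)

lemma fl_le: "a \<in> D \<Longrightarrow> r \<le> a \<Longrightarrow> fl r \<le> a"
  by (cases "r \<in> D") (use fl_nearest[of a r] fl_in[of r] in \<open>force+\<close>)

lemma mantissa_bound_powi: "2 ^ p * 2 powi k = (2::real) powi (int p + k)"
  by (simp add: power_int_add)

lemma D_E:
  assumes "a \<in> D"
  obtains k where "Emin \<le> k" "k \<le> Emax" "a \<in> grid k" "\<bar>a\<bar> < 2 powi (int p + k)"
proof -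
  obtain m e where *: "a = of_int m * 2 powi e" "\<bar>m\<bar> < 2 ^ p" "Emin \<le> e" "e \<le> Emax"
    using assms unfolding dekker_def by blast
  have "real_of_int \<bar>m\<bar> < 2 ^ p" using *(2) by (metis of_int_less_iff of_int_numeral of_int_power)
  then have "\<bar>a\<bar> < 2 powi (int p + e)"
    unfolding mantissa_bound_powi[symmetric] by (simp add: *(1) abs_mult)
  moreover have "a \<in> grid e" using * by (auto simp: grid_def)
  ultimately show ?thesis using * that by blast
qed

lemma D_I:
  assumes "Emin \<le> k" "k \<le> Emax" "a \<in> grid k" "\<bar>a\<bar> < 2 powi (int p + k)"
  shows "a \<in> D"
proof -
  obtain m where m: "a = of_int m * 2 powi k" using assms by (auto simp: grid_def)
  have "real_of_int \<bar>m\<bar> < 2 ^ p"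
    using assms(4) unfolding mantissa_bound_powi[symmetric] by (simp add: m abs_mult)
  then have "\<bar>m\<bar> < 2 ^ p" by (metis of_int_less_iff of_int_numeral of_int_power)
  with m assms show ?thesis unfolding dekker_def by blast
qed

lemma Om_less: "Om < 2 powi (int p + Emax)"
  by (simp add: max_float_def mantissa_bound_powi[symmetric])

lemma Om_grid: "k \<le> Emax \<Longrightarrow> Om \<in> grid k"
  by (rule grid_mono[of _ Emax])
     (auto simp: max_float_def grid_def intro: range_eqI[of _ _ "2 ^ p - 1"])

text \<open>The closed bound is admissible because its endpoint is divisible by
  \<open>2 powi (k + 1)\<close>, as \<open>p \<ge> 1\<close>, and so fits the next exponent. For
  \<open>k \<ge> Emax\<close> the bound \<open>Om\<close> takes over, with exponent
  \<open>Emax\<close>.\<close>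

lemma D_of_grid:
  assumes k: "Emin \<le> k" and a: "a \<in> grid k" "\<bar>a\<bar> \<le> 2 powi (int p + k)" and "\<bar>a\<bar> \<le> Om"
  shows "a \<in> D"
proof (cases "k \<ge> Emax")
  case True
  have "a \<in> grid Emax" using True a(1) by (rule grid_mono)
  with E assms(4) Om_less show ?thesis by (intro D_I[of Emax]) auto
next
  case False
  show ?thesis
  proof (cases "\<bar>a\<bar> < 2 powi (int p + k)")
    case True
    with False assms show ?thesis by (intro D_I[of k]) auto
  next
    case c: False
    then have eq: "\<bar>a\<bar> = 2 powi (int p + k)" using a by simp
    have "2 powi (int p + k) \<in> grid (k + 1)" using p by (intro powi_in_grid) simp
    moreover have "(0::real) \<in> grid (k + 1)" by (auto simp: grid_def intro: range_eqI[of _ _ 0])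
    moreover have "a = 2 powi (int p + k) \<or> a = 0 - 2 powi (int p + k)" using eq by linarith
    ultimately have "a \<in> grid (k + 1)" by (blast intro: grid_diff)
    with eq False k show ?thesis by (intro D_I[of "k + 1"]) (auto simp: powi2_less_iff)
  qed
qed

lemma uminus_D: "a \<in> D \<Longrightarrow> - a \<in> D"
proof -
  assume "a \<in> D"
  then obtain k where k: "Emin \<le> k" "k \<le> Emax" "a \<in> grid k" "\<bar>a\<bar> < 2 powi (int p + k)"
    by (rule D_E)
  have "- a \<in> grid k" using k(3) unfolding grid_def by (auto simp flip: of_int_minus mult_minus_left)
  with k show ?thesis by (intro D_I[of k]) auto
qed

lemma zero_D [simp]: "0 \<in> D"
  using E by (intro D_I[of Emin]) (auto simp: grid_def intro: range_eqI[of _ _ 0])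

text \<open>An exponent \<open>j\<close> of \<open>a\<close> satisfies
  \<open>\<bar>a\<bar> < 2 powi (int p + j)\<close>, so the lower bound forces
  \<open>k \<le> j\<close>. Together with \<open>le_fl\<close> this locates rounded values on a
  grid.\<close>

lemma D_large_grid:
  assumes "a \<in> D" "2 powi (int p + k - 1) \<le> \<bar>a\<bar>"
  shows "a \<in> grid k"
proof -
  obtain j where j: "a \<in> grid j" "\<bar>a\<bar> < 2 powi (int p + j)" using assms(1) by (rule D_E)
  have "(2::real) powi (int p + k - 1) < 2 powi (int p + j)" using j assms by linarith
  then have "k \<le> j" unfolding powi2_less_iff by simp
  with j show ?thesis by (blast intro: grid_mono)
qed

lemma D_grid_Emin: "a \<in> D \<Longrightarrow> a \<in> grid Emin"
  by (erule D_E) (rule grid_mono)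

text \<open>With \<open>j\<close> an exponent of \<open>a\<close>, the exponent
  \<open>min k j\<close> represents the power: either the mantissa is 1, or it is
  \<open>2 ^ (k - j)\<close> with \<open>k - j < p\<close>.\<close>

lemma powi_D:
  assumes "Emin \<le> k" "2 powi k \<le> \<bar>a\<bar>" "a \<in> D"
  shows "2 powi k \<in> D"
proof -
  obtain j where j: "a \<in> grid j" "j \<le> Emax" "Emin \<le> j" "\<bar>a\<bar> < 2 powi (int p + j)"
    using assms(3) by (rule D_E)
  have "(2::real) powi k < 2 powi (int p + j)" using j assms by linarith
  then have "k < int p + j" by (simp add: powi2_less_iff)
  then show ?thesis
    using j assms p by (intro D_I[of "min k j"]) (auto simp: powi2_less_iff min_def intro!: powi_in_grid)
qed

text \<open>Dekker's representations are not unique; this one has a full mantissa of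
  \<open>p\<close> digits unless the exponent is already the least one.\<close>

lemma normal_form:
  assumes "a \<in> D"
  obtains k where "Emin \<le> k" "k \<le> Emax" "a \<in> grid k" "\<bar>a\<bar> < 2 powi (int p + k)"
    "k = Emin \<or> 2 powi (int p + k - 1) \<le> \<bar>a\<bar>"
proof (cases "\<bar>a\<bar> < 2 powi (int p + Emin)")
  case True
  with that[of Emin] assms E show ?thesis by (auto intro: D_grid_Emin)
next
  case False
  then have "\<bar>a\<bar> > 0" by (smt (verit) zero_less_power_int)
  then obtain l where l: "2 powi l \<le> \<bar>a\<bar>" "\<bar>a\<bar> < 2 powi (l + 1)" using ex_powi2_le_less by blast
  define k where "k = l + 1 - int p"
  have k: "2 powi (int p + k - 1) \<le> \<bar>a\<bar>" "\<bar>a\<bar> < 2 powi (int p + k)"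
    using l by (simp_all add: k_def)
  have "(2::real) powi (int p + Emin) < 2 powi (int p + k)" using False k by linarith
  then have "Emin \<le> k" unfolding powi2_less_iff by simp
  moreover have "k \<le> Emax"
  proof -
    obtain j where j: "j \<le> Emax" "\<bar>a\<bar> < 2 powi (int p + j)" using assms by (rule D_E)
    have "(2::real) powi (int p + k - 1) < 2 powi (int p + j)" using j k by linarith
    then show ?thesis unfolding powi2_less_iff using j by simp
  qed
  ultimately show ?thesis using that k D_large_grid[OF assms k(1)] by blast
qed

section \<open>Rounding error bounds\<close>

text \<open>The nearest multiple of the spacing lies in \<open>D\<close>, hence competes with
  \<open>fl r\<close>, and is at most half a spacing away.\<close>

lemma fl_error_abs:
  assumes k: "Emin \<le> k" and r: "\<bar>r\<bar> \<le> 2 powi (int p + k)" "\<bar>r\<bar> \<le> Om"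
  shows "\<bar>fl r - r\<bar> \<le> 2 powi k / 2"
proof -
  \<comment> \<open>\<open>k\<close> may exceed \<open>Emax\<close>, so the exponent is capped;
    \<open>Om\<close> then bounds \<open>r\<close> at \<open>Emax\<close>.\<close>
  define j where "j = min k Emax"
  have j: "Emin \<le> j" "j \<le> Emax" "j \<le> k" using k E by (auto simp: j_def)
  have rj: "\<bar>r\<bar> \<le> 2 powi (int p + j)" using r Om_less by (auto simp: j_def min_def)
  define q :: real where "q = 2 powi j"
  have q: "q > 0" by (simp add: q_def)
  define a where "a = of_int (round (r / q)) * q"
  have a: "a \<in> grid j" by (auto simp: a_def grid_def q_def)
  \<comment> \<open>Rounding to the grid is monotone and fixes the grid points \<open>B\<close> and
    \<open>- B\<close>, so it cannot leave the interval between them. This is used for both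
    \<open>2 powi (int p + j)\<close> and \<open>Om\<close>.\<close>
  have bnd: "\<bar>a\<bar> \<le> B" if "\<bar>r\<bar> \<le> B" and "B \<in> grid j" for B
  proof -
    obtain m where m: "B = of_int m * q" using \<open>B \<in> grid j\<close> by (auto simp: grid_def q_def)
    have "r / q \<le> of_int m" "of_int (- m) \<le> r / q"
      using that(1) q by (auto simp: m field_simps)
    then have "round (r / q) \<le> m" "- m \<le> round (r / q)"
      by (metis round_mono round_of_int)+
    then have "\<bar>real_of_int (round (r / q))\<bar> \<le> of_int m" by linarith
    then show ?thesis using q by (simp add: a_def m abs_mult)
  qed
  have "2 powi (int p + j) \<in> grid j" by (rule powi_in_grid) simp
  with bnd rj have "\<bar>a\<bar> \<le> 2 powi (int p + j)" by blast
  moreover have "\<bar>a\<bar> \<le> Om" using bnd r(2) Om_grid[OF j(2)] by blast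
  ultimately have "a \<in> D" using D_of_grid a j by blast
  then have "\<bar>fl r - r\<bar> \<le> \<bar>a - r\<bar>" by (rule fl_nearest)
  also have "\<dots> = \<bar>of_int (round (r / q)) - r / q\<bar> * q"
    using q by (simp add: a_def abs_mult_pos' field_simps)
  also have "\<dots> \<le> 1 / 2 * q"
    using of_int_round_abs_le[of "r / q"] q by (intro mult_right_mono) auto
  also have "\<dots> \<le> 2 powi k / 2" using powi2_le[OF j(3)] by (simp add: q_def)
  finally show ?thesis .
qed

text \<open>A small \<open>r\<close> is representable and left unchanged; a large one rounds to a
  number so large that its exponent is at least \<open>k\<close>.\<close>

lemma fl_grid:
  assumes k: "Emin \<le> k" and r: "r \<in> grid k" "\<bar>r\<bar> \<le> Om"
  shows "fl r \<in> grid k"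
proof (cases "\<bar>r\<bar> \<le> 2 powi (int p + k)")
  case True
  with assms have "r \<in> D" by (intro D_of_grid)
  with r show ?thesis by simp
next
  case False
  let ?b = "2 powi (int p + k)"
  have b: "?b \<in> D" using False r k by (intro D_of_grid) (auto intro!: powi_in_grid)
  have "?b \<le> \<bar>fl r\<bar>"
    using False le_fl[OF b, of r] fl_le[OF uminus_D[OF b], of r] by linarith
  then have "2 powi (int p + k - 1) \<le> \<bar>fl r\<bar>" using powi2_le[of "int p + k - 1" "int p + k"] by linarith
  then show ?thesis by (intro D_large_grid) auto
qed

lemma add_grid_Emin: "a \<in> D \<Longrightarrow> b \<in> D \<Longrightarrow> a + b \<in> grid Emin"
  by (intro grid_add D_grid_Emin)

text \<open>Multiples of \<open>2 powi Emin\<close> are exact in the underflow range, so no absolute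
  error term appears. Elsewhere half the spacing is \<open>unit_roundoff p\<close> times the leading
  power of two of \<open>r\<close>.\<close>

lemma fl_error_rel:
  assumes "r \<in> grid Emin" "\<bar>r\<bar> \<le> Om"
  shows "\<bar>fl r - r\<bar> \<le> unit_roundoff p * \<bar>r\<bar>"
proof (cases "\<bar>r\<bar> \<le> 2 powi (int p + Emin)")
  case True
  with assms have "r \<in> D" by (intro D_of_grid[of Emin]) auto
  then show ?thesis by (simp add: unit_roundoff_eq)
next
  case False
  then have "\<bar>r\<bar> > 0" by (smt (verit) zero_less_power_int)
  then obtain l where l: "2 powi l \<le> \<bar>r\<bar>" "\<bar>r\<bar> < 2 powi (l + 1)" using ex_powi2_le_less by blast
  define k where "k = l + 1 - int p"
  have k: "\<bar>r\<bar> < 2 powi (int p + k)" using l by (simp add: k_def)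
  have "(2::real) powi (int p + Emin) < 2 powi (int p + k)" using False k by linarith
  then have "Emin \<le> k" unfolding powi2_less_iff by simp
  then have "\<bar>fl r - r\<bar> \<le> 2 powi k / 2" using k assms by (intro fl_error_abs) auto
  also have "\<dots> = unit_roundoff p * 2 powi l"
    by (simp add: unit_roundoff_eq k_def power_int_diff powi2_Suc)
  also have "\<dots> \<le> unit_roundoff p * \<bar>r\<bar>"
    using l by (intro mult_left_mono) (auto simp: unit_roundoff_eq)
  finally show ?thesis .
qed

section \<open>Representability of errors and differences\<close>

text \<open>\<open>c\<close> can take the smaller of the exponents of \<open>a\<close> and
  \<open>b\<close>; being no larger than the operand with that exponent, it also fits the
  mantissa.\<close>

lemma small_combination_D:
  assumes "a \<in> D" "b \<in> D" "\<bar>c\<bar> \<le> \<bar>a\<bar>" "\<bar>c\<bar> \<le> \<bar>b\<bar>"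
    and c: "\<And>k. Emin \<le> k \<Longrightarrow> a \<in> grid k \<Longrightarrow> b \<in> grid k \<Longrightarrow> c \<in> grid k"
  shows "c \<in> D"
proof -
  obtain i where i: "Emin \<le> i" "i \<le> Emax" "a \<in> grid i" "\<bar>a\<bar> < 2 powi (int p + i)"
    using assms(1) by (rule D_E)
  obtain j where j: "Emin \<le> j" "j \<le> Emax" "b \<in> grid j" "\<bar>b\<bar> < 2 powi (int p + j)"
    using assms(2) by (rule D_E)
  have "c \<in> grid (min i j)"
    using i j by (intro c) (auto intro: grid_mono[of _ i] grid_mono[of _ j])
  with i j assms(3,4) show ?thesis by (intro D_I[of "min i j"]) (auto simp: min_def)
qed

text \<open>Both \<open>a\<close> and \<open>b\<close> compete with \<open>fl (a + b)\<close>; their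
  distances to \<open>a + b\<close> are \<open>\<bar>b\<bar>\<close> and
  \<open>\<bar>a\<bar>\<close>, so the error is no larger than either operand.\<close>

lemma error_D:
  assumes "a \<in> D" "b \<in> D" "\<bar>a + b\<bar> \<le> Om"
  shows "a + b - fl (a + b) \<in> D"
proof (rule small_combination_D[OF assms(1,2)])
  show "\<bar>a + b - fl (a + b)\<bar> \<le> \<bar>a\<bar>" using fl_nearest[OF assms(2), of "a + b"] by simp
  show "\<bar>a + b - fl (a + b)\<bar> \<le> \<bar>b\<bar>" using fl_nearest[OF assms(1), of "a + b"] by simp
qed (use assms(3) in \<open>blast intro: grid_diff grid_add fl_grid\<close>)

text \<open>The inequalities force \<open>a\<close> and \<open>b\<close> to be nonnegative and
  \<open>\<bar>a - b\<bar> \<le> min a b\<close>.\<close>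

lemma sterbenz:
  assumes "a \<in> D" "b \<in> D" "b \<le> 2 * a" "a \<le> 2 * b"
  shows "a - b \<in> D"
  by (rule small_combination_D[OF assms(1,2)]) (use assms in \<open>auto intro: grid_diff\<close>)

text \<open>
  Ties need not be broken symmetrically, so sign reductions pass to the reflected rounding
  instead of using that \<open>fl\<close> is odd, which may fail.
\<close>

lemma neg_rounding: "dekker_rounding p Emin Emax (\<lambda>r. - fl (- r))"
proof
  show "nearest_rounding D (\<lambda>r. - fl (- r))"
    unfolding nearest_rounding_def
  proof (intro allI conjI ballI)
    fix r a assume "a \<in> D"
    then show "\<bar>- fl (- r) - r\<bar> \<le> \<bar>a - r\<bar>" using fl_nearest[OF uminus_D, of a "- r"] by simp
  qed (simp add: uminus_D)
qed (use p E in auto)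

section \<open>Exactness of two-sum\<close>

text \<open>Either \<open>z\<close> stays on the grid of \<open>x\<close>, or strong cancellation
  makes the sum exact by Sterbenz, or \<open>z\<close> drops exactly one binade below
  \<open>x\<close>, in which case \<open>\<bar>y\<bar> < x / 2\<close> makes the difference small
  enough for the finer grid.\<close>

lemma fast2sum_pos:
  assumes x: "x \<in> D" and y: "y \<in> D" and xy: "\<bar>y\<bar> \<le> x"
    and Om: "\<bar>x + y\<bar> \<le> Om" "\<bar>fl (x + y) - x\<bar> \<le> Om"
  shows "fl (x + y) - x \<in> D"
proof -
  define z where "z = fl (x + y)"
  have z: "z \<in> D" by (simp add: z_def)
  obtain k where k: "Emin \<le> k" "k \<le> Emax" "x \<in> grid k" "\<bar>x\<bar> < 2 powi (int p + k)"
    "k = Emin \<or> 2 powi (int p + k - 1) \<le> \<bar>x\<bar>" using x by (rule normal_form)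
  have x0: "x \<ge> 0" using xy by simp
  consider "z \<in> grid k" | "x \<le> 2 * (- y)" | "z \<notin> grid k" "x > 2 * (- y)" by linarith
  then show ?thesis
  proof cases
    case 1
    have "\<bar>x + y\<bar> \<le> 2 powi (int p + (k + 1))"
      using xy k(4) powi2_Suc[of "int p + k"] x0 by (simp add: add.assoc)
    then have "\<bar>z - (x + y)\<bar> \<le> 2 powi (k + 1) / 2"
      unfolding z_def using k Om by (intro fl_error_abs) auto
    then have "\<bar>z - x\<bar> < 2 powi (int p + k) + 2 powi k"
      using xy k(4) x0 powi2_Suc[of k] by linarith
    moreover have "z - x \<in> grid k" "x - z \<in> grid k" "2 powi (int p + k) \<in> grid k"
      using 1 k by (auto intro: grid_diff powi_in_grid)
    ultimately have "\<bar>z - x\<bar> \<le> 2 powi (int p + k)"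
      using grid_gap[of "2 powi (int p + k)" k "z - x"] grid_gap[of "2 powi (int p + k)" k "x - z"]
      by linarith
    with 1 k Om show ?thesis by (intro D_of_grid[of k]) (auto intro: grid_diff simp: z_def)
  next
    case 2
    then have "x - (- y) \<in> D" using xy by (intro sterbenz x uminus_D y) auto
    then show ?thesis using y by simp
  next
    case 3
    \<comment> \<open>Every element of \<open>D\<close> is on the grid at \<open>Emin\<close>, so
      leaving the grid at \<open>k\<close> leaves room for the exponent
      \<open>k - 1\<close>.\<close>
    have kE: "k \<noteq> Emin" using 3(1) D_grid_Emin[OF z] by auto
    then have kx: "2 powi (int p + k - 1) \<le> x" using k(5) x0 by simp
    have zlt: "\<bar>z\<bar> < 2 powi (int p + k - 1)" using D_large_grid[OF z, of k] 3 by linarith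
    have "2 powi (int p + k - 1) \<in> D"
      using kx x0 x k p by (intro powi_D[of _ x]) auto
    from le_fl[OF this, of "x + y"] have le: "x + y \<le> 2 powi (int p + (k - 1))"
      using zlt by (fold z_def) (force simp: algebra_simps)
    \<comment> \<open>Since \<open>x + y > x / 2\<close>, the sum stays above half the leading power
      of \<open>x\<close>; rounding preserves this, so \<open>z\<close> falls by one binade
      only.\<close>
    have "2 powi (int p + (k - 1) - 1) \<in> D"
      using kx x0 x k kE p powi2_le[of "int p + (k - 1) - 1" "int p + k - 1"]
      by (intro powi_D[of _ x]) auto
    moreover have "2 powi (int p + (k - 1) - 1) \<le> x + y"
      using 3(2) kx powi2_pred[of "int p + k - 1"] by (simp add: algebra_simps)
    ultimately have "2 powi (int p + (k - 1) - 1) \<le> z" unfolding z_def by (rule le_fl)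
    then have zg: "z \<in> grid (k - 1)" by (intro D_large_grid[OF z]) auto
    have xg: "x \<in> grid (k - 1)" using k(3) by (rule grid_mono[rotated]) simp
    have "\<bar>z - (x + y)\<bar> \<le> 2 powi (k - 1) / 2"
      unfolding z_def using k kE Om le xy by (intro fl_error_abs) auto
    moreover have "- x / 2 < y" "y \<le> 0"
      using 3(2) le kx by (auto simp: algebra_simps)
    moreover have "(0::real) < 2 powi (k - 1)" by simp
    ultimately have "\<bar>z - x\<bar> < 2 powi (int p + (k - 1)) + 2 powi (k - 1)"
      using k(4) powi2_pred[of "int p + k"] x0 unfolding add_diff_eq[of "int p"] by linarith
    moreover have "z - x \<in> grid (k - 1)" "x - z \<in> grid (k - 1)"
       "2 powi (int p + (k - 1)) \<in> grid (k - 1)"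
      using zg xg by (auto intro: grid_diff powi_in_grid)
    ultimately have "\<bar>z - x\<bar> \<le> 2 powi (int p + (k - 1))"
      using grid_gap[of "2 powi (int p + (k - 1))" "k - 1" "z - x"]
        grid_gap[of "2 powi (int p + (k - 1))" "k - 1" "x - z"]
      by linarith
    with zg xg k kE Om show ?thesis
      by (intro D_of_grid[of "k - 1"]) (auto intro: grid_diff simp: z_def)
  qed
qed

lemma fast2sum:
  assumes x: "x \<in> D" and y: "y \<in> D" and xy: "\<bar>y\<bar> \<le> \<bar>x\<bar>"
    and Om: "\<bar>x + y\<bar> \<le> Om" "\<bar>fl (x + y) - x\<bar> \<le> Om"
  shows "fl (x + y) - x \<in> D"
proof (cases "x \<ge> 0")
  case True
  with assms show ?thesis by (intro fast2sum_pos) auto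
next
  case False
  interpret neg: dekker_rounding p Emin Emax "\<lambda>r. - fl (- r)" by (rule neg_rounding)
  have "- fl (x + y) + x \<in> D"
    using neg.fast2sum_pos[of "- x" "- y"] assms False
    by (auto simp: uminus_D abs_minus_commute add.commute)
  from uminus_D[OF this] show ?thesis by simp
qed

text \<open>
  The worst case is \<open>y = 2 powi (p + k - 1)\<close>, where the spacing halves just below \<open>y\<close>: there
  monotonicity of the rounding keeps \<open>w\<close> at or above the predecessor of \<open>y\<close>. This is what
  makes the argument work even for \<open>p = 1\<close>.
\<close>

lemma virtual_error_D_pos:
  fixes x y
  defines "z \<equiv> fl (x + y)"
  defines "w \<equiv> fl (z - x)"
  assumes x: "x \<in> D" and y: "y \<in> D" and xy: "\<bar>x\<bar> < y"
    and Om: "\<bar>x + y\<bar> \<le> Om" "\<bar>z - x\<bar> \<le> Om" "\<bar>y - w\<bar> \<le> Om"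
  shows "y - w \<in> D"
proof -
  obtain k where k: "Emin \<le> k" "k \<le> Emax" "y \<in> grid k" "\<bar>y\<bar> < 2 powi (int p + k)"
    "k = Emin \<or> 2 powi (int p + k - 1) \<le> \<bar>y\<bar>" using y by (rule normal_form)
  have w: "w \<in> D" by (simp add: w_def)
  have "\<bar>x + y\<bar> \<le> 2 powi (int p + (k + 1))"
    using xy k(4) powi2_Suc[of "int p + k"] by (simp add: add.assoc)
  then have "\<bar>z - (x + y)\<bar> \<le> 2 powi (k + 1) / 2"
    unfolding z_def using k Om by (intro fl_error_abs) auto
  then have zerr: "\<bar>z - (x + y)\<bar> \<le> 2 powi k" by (simp add: powi2_Suc)
  have p2: "(2::real) * 2 powi k \<le> 2 powi (int p + k)"
    using powi2_le[of "k + 1" "int p + k"] p by (simp add: powi2_Suc)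
  have ygap: "y + 2 powi k \<le> 2 powi (int p + k)"
    using k by (intro grid_gap) (auto intro: powi_in_grid)
  have werr: "\<bar>w - (z - x)\<bar> \<le> 2 powi k / 2"
    unfolding w_def using k Om zerr ygap xy p2 by (intro fl_error_abs) auto
  \<comment> \<open>The two errors add up to at most \<open>3/2 * 2 powi k\<close>, which settles
    the size of \<open>y - w\<close>; in the first two cases only divisibility of \<open>w\<close>
    remains.\<close>
  have "\<bar>y - w\<bar> \<le> 2 powi (int p + k)" using zerr werr p2 by linarith
  then have on_grid: "y - w \<in> D" if "w \<in> grid k"
    using that k(1,3) Om(3) by (intro D_of_grid[of k] grid_diff)
  consider "k = Emin" | "2 powi (int p + k - 1) < y" | "k \<noteq> Emin" "y = 2 powi (int p + k - 1)"
    using k(5) xy by linarith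
  then show ?thesis
  proof cases
    case 1
    with w on_grid show ?thesis by (auto intro: D_grid_Emin)
  next
    case 2
    have b: "2 powi (int p + k - 1) \<in> D"
      using 2 xy y k p by (intro powi_D[of _ y]) auto
    \<comment> \<open>A whole spacing separates \<open>y\<close> from the bottom of its binade and
      absorbs the error of \<open>z\<close>.\<close>
    have "2 powi (int p + k - 1) + 2 powi k \<le> y"
      using 2 k p by (intro grid_gap) (auto intro!: powi_in_grid)
    then have "2 powi (int p + k - 1) \<le> z - x" using zerr by linarith
    then have "2 powi (int p + k - 1) \<le> w" unfolding w_def by (rule le_fl[OF b])
    then show ?thesis by (intro on_grid D_large_grid[OF w]) auto
  next
    case 3
    have kE: "Emin \<le> k - 1" using k 3 by simp
    \<comment> \<open>Here \<open>x + y < 2 * y = 2 powi (int p + k)\<close>, one binade below the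
      general bound, so the error is halved.\<close>
    have "\<bar>z - (x + y)\<bar> \<le> 2 powi k / 2"
      unfolding z_def using k Om xy powi2_pred[of "int p + k"] 3 by (intro fl_error_abs) auto
    then have zx: "\<bar>z - x - y\<bar> \<le> 2 powi (k - 1)" by (simp add: powi2_pred diff_diff_eq)
    define b :: real where "b = 2 powi (int p + k - 1) - 2 powi (k - 1)"
    have yg: "y \<in> grid (k - 1)" using k(3) by (rule grid_mono[rotated]) simp
    \<comment> \<open>For \<open>p = 1\<close> this is an equality: \<open>b\<close> is then
      \<open>2 powi (k - 1)\<close>.\<close>
    have b_half: "2 powi (int p + (k - 1) - 1) \<le> b"
      using powi2_le[of k "int p + k - 1"] powi2_pred[of "int p + k - 1"] powi2_pred[of k] p
      by (simp add: b_def algebra_simps)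
    have b0: "b > 0" by (rule less_le_trans[OF _ b_half]) simp
    have bD: "b \<in> D"
      using b0 kE k(2) p unfolding b_def
      by (intro D_I[of "k - 1"]) (auto intro!: grid_diff powi_in_grid simp: algebra_simps)
    have "b \<le> z - x" using zx by (simp add: b_def 3)
    then have bw: "b \<le> w" unfolding w_def by (rule le_fl[OF bD])
    then have "w \<in> grid (k - 1)" using b_half by (intro D_large_grid[OF w]) auto
    then have "y - w \<in> grid (k - 1)" using yg by (rule grid_diff[rotated])
    moreover have "\<bar>y - w\<bar> \<le> 2 powi (int p + (k - 1))"
    proof -
      have "y - w \<le> 2 powi (k - 1)" using bw by (simp add: b_def 3)
      moreover have "w - y \<le> 2 powi k" using zx werr unfolding powi2_pred by linarith
      moreover have "(2::real) powi k \<le> 2 powi (int p + (k - 1))" using p by (intro powi2_le) simp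
      moreover have "(2::real) powi (k - 1) \<le> 2 powi k" by (intro powi2_le) simp
      ultimately show ?thesis by linarith
    qed
    ultimately show ?thesis using kE Om by (intro D_of_grid[of "k - 1"])
  qed
qed

lemma virtual_error_D:
  fixes x y
  defines "z \<equiv> fl (x + y)"
  defines "w \<equiv> fl (z - x)"
  assumes x: "x \<in> D" and y: "y \<in> D" and xy: "\<bar>x\<bar> < \<bar>y\<bar>"
    and Om: "\<bar>x + y\<bar> \<le> Om" "\<bar>z - x\<bar> \<le> Om" "\<bar>y - w\<bar> \<le> Om"
  shows "y - w \<in> D"
proof (cases "y \<ge> 0")
  case True
  with assms show ?thesis unfolding z_def w_def by (intro virtual_error_D_pos) auto
next
  case False
  interpret neg: dekker_rounding p Emin Emax "\<lambda>r. - fl (- r)" by (rule neg_rounding)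
  have "- y + w \<in> D"
    using neg.virtual_error_D_pos[of "- x" "- y"] assms False
    by (auto simp: uminus_D abs_minus_commute algebra_simps)
  from uminus_D[OF this] show ?thesis by simp
qed

text \<open>Once \<open>y - w\<close>, \<open>w - z\<close> and \<open>x + (w - z)\<close> are in
  \<open>D\<close>, the later roundings do nothing and the two partial errors telescope to
  \<open>x + y - z\<close>, which \<open>error_D\<close> puts in \<open>D\<close>.\<close>

lemma add6_exact:
  assumes x: "x \<in> D" and y: "y \<in> D" and no: "add6_no_overflow Om fl x y"
  shows "add6 fl x y = (fl (x + y), x + y - fl (x + y))"
proof -
  define z where "z = fl (x + y)"
  define w where "w = fl (z - x)"
  have Om: "\<bar>x + y\<bar> \<le> Om" "\<bar>z - x\<bar> \<le> Om" "\<bar>y - w\<bar> \<le> Om" "\<bar>w - z\<bar> \<le> Om"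
    using no by (auto simp: add6_no_overflow_def Let_def z_def w_def)
  have z: "z \<in> D" by (simp add: z_def)
  have err: "x + y - z \<in> D" unfolding z_def using x y Om by (intro error_D)
  have "y - w \<in> D \<and> w - z \<in> D \<and> x + (w - z) \<in> D"
  proof (cases "z - x \<in> D")
    case True
    then have "w = z - x" by (simp add: w_def)
    then have "y - w = x + y - z" "w - z = - x" "x + (w - z) = 0" by simp_all
    with err x show ?thesis by (simp only: uminus_D zero_D simp_thms)
  next
    case False
    then have xy: "\<bar>x\<bar> < \<bar>y\<bar>" using fast2sum[OF x y] Om by (force simp: z_def)
    \<comment> \<open>Otherwise
      \<open>\<bar>x + y\<bar> \<le> \<bar>x\<bar> < \<bar>y\<bar>\<close>, so the signs are
      opposite and \<open>\<bar>y\<bar> \<le> 2 * \<bar>x\<bar>\<close>; the sum is then exact and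
      \<open>z - x = y\<close> is representable, a contradiction.\<close>
    have "\<bar>x\<bar> \<le> \<bar>z\<bar>"
    proof (rule ccontr)
      assume zx: "\<not> \<bar>x\<bar> \<le> \<bar>z\<bar>"
      have "\<bar>x + y\<bar> \<le> \<bar>x\<bar>"
      proof (rule ccontr)
        assume "\<not> ?thesis"
        moreover have "\<bar>x\<bar> \<in> D" "- \<bar>x\<bar> \<in> D" using x uminus_D by (auto simp: abs_if)
        ultimately show False
          using zx le_fl[of "\<bar>x\<bar>" "x + y"] fl_le[of "- \<bar>x\<bar>" "x + y"] by (fold z_def) linarith
      qed
      then have "x - (- y) \<in> D"
        using sterbenz[OF x uminus_D[OF y]] sterbenz[OF uminus_D[OF x] y] xy
          uminus_D[of "- x - y"] by (cases "y \<ge> 0") (auto simp: algebra_simps)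
      then show False using False y by (simp add: z_def)
    qed
    \<comment> \<open>The fast two-sum result and \<open>error_D\<close> are reused for the sum of
      \<open>z\<close> and \<open>- x\<close>, whose rounding is \<open>w\<close>.\<close>
    then have "fl (z + - x) - z \<in> D"
      using Om z x by (intro fast2sum) (auto simp: uminus_D w_def)
    moreover have "z + - x - fl (z + - x) \<in> D"
      using Om z x by (intro error_D) (auto simp: uminus_D)
    from uminus_D[OF this] have "x + (w - z) \<in> D" by (simp add: w_def algebra_simps)
    moreover have "y - w \<in> D" using virtual_error_D[OF x y xy] Om by (simp add: z_def w_def)
    ultimately show ?thesis by (simp add: w_def)
  qed
  moreover have "(y - w) + (x + (w - z)) = x + y - z" by simp
  ultimately show ?thesis using err
    by (simp only: add6_def Let_def z_def[symmetric] w_def[symmetric] fl_id)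
qed

section \<open>Relative perturbations\<close>

lemma fl_add_perturbation:
  assumes "a \<in> D" "b \<in> D" "\<bar>a + b\<bar> \<le> Om"
  shows "\<exists>\<delta>. \<bar>\<delta>\<bar> \<le> unit_roundoff p \<and> fl (a + b) = (1 + \<delta>) * (a + b)"
proof (cases "a + b = 0")
  case True
  then show ?thesis by (intro exI[of _ 0]) (simp add: unit_roundoff_eq)
next
  case False
  have "\<bar>fl (a + b) - (a + b)\<bar> \<le> unit_roundoff p * \<bar>a + b\<bar>"
    using assms by (intro fl_error_rel add_grid_Emin)
  with False show ?thesis
    by (intro exI[of _ "(fl (a + b) - (a + b)) / (a + b)"]) (simp add: field_simps)
qed

text \<open>As \<open>zz\<close> is the exact error of \<open>z\<close>, a single \<delta> describes
  both components.\<close>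

lemma add6_perturbation:
  assumes "a \<in> D" "b \<in> D" "add6_no_overflow Om fl a b" and "(z, zz) = add6 fl a b"
  shows "z \<in> D" "zz \<in> D" "\<exists>\<delta>. \<bar>\<delta>\<bar> \<le> unit_roundoff p \<and> z = (1 + \<delta>) * (a + b) \<and> zz = - \<delta> * (a + b)"
proof -
  have le: "\<bar>a + b\<bar> \<le> Om" using assms(3) by (simp add: add6_no_overflow_def Let_def)
  have eq: "z = fl (a + b)" "zz = a + b - fl (a + b)"
    using add6_exact[OF assms(1-3)] assms(4) by auto
  show "z \<in> D" "zz \<in> D" using eq error_D[OF assms(1,2) le] by auto
  obtain \<delta> where "\<bar>\<delta>\<bar> \<le> unit_roundoff p" "fl (a + b) = (1 + \<delta>) * (a + b)"
    using fl_add_perturbation[OF assms(1,2) le] by blast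
  then show "\<exists>\<delta>. \<bar>\<delta>\<bar> \<le> unit_roundoff p \<and> z = (1 + \<delta>) * (a + b) \<and> zz = - \<delta> * (a + b)"
    using eq by (intro exI[of _ \<delta>]) (simp add: algebra_simps)
qed

end

section \<open>Products, recurrences and weighted sums\<close>

text \<open>Induction through
  \<open>(1 + \<theta>) * P - 1 = (1 + \<theta>) * (P - 1) + \<theta>\<close>; the extreme case has
  every factor equal to \<open>1 + \<sigma>\<close>.\<close>

lemma prod_one_plus_minus_one_abs_le:
  fixes \<theta> :: "'a \<Rightarrow> real"
  assumes "finite I" "\<And>i. i \<in> I \<Longrightarrow> \<bar>\<theta> i\<bar> \<le> \<sigma>"
  shows "\<bar>(\<Prod>i\<in>I. 1 + \<theta> i) - 1\<bar> \<le> (1 + \<sigma>) ^ card I - 1"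
  using assms
proof (induction I rule: finite_induct)
  case (insert j I)
  define P where "P = (\<Prod>i\<in>I. 1 + \<theta> i)"
  have IH: "\<bar>P - 1\<bar> \<le> (1 + \<sigma>) ^ card I - 1" unfolding P_def using insert by auto
  have t: "\<bar>\<theta> j\<bar> \<le> \<sigma>" using insert.prems by simp
  have "\<bar>(1 + \<theta> j) * P - 1\<bar> = \<bar>(1 + \<theta> j) * (P - 1) + \<theta> j\<bar>" by (simp add: algebra_simps)
  also have "\<dots> \<le> \<bar>1 + \<theta> j\<bar> * \<bar>P - 1\<bar> + \<bar>\<theta> j\<bar>"
    by (metis abs_mult abs_triangle_ineq)
  also have "\<dots> \<le> (1 + \<sigma>) * ((1 + \<sigma>) ^ card I - 1) + \<sigma>"
    using t IH by (intro add_mono mult_mono) auto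
  finally show ?case using insert.hyps by (simp add: P_def algebra_simps)
qed simp

lemma one_plus_power_minus_one_le:
  fixes \<sigma> :: real
  assumes "\<sigma> \<ge> 0" "real m * \<sigma> < 1"
  shows "(1 + \<sigma>) ^ m - 1 \<le> real m * \<sigma> / (1 - real m * \<sigma>)"
proof (cases "m = 0")
  case False
  then have "\<sigma> \<le> real m * \<sigma>" using assms(1) by (simp add: mult_le_cancel_right1)
  then have s: "\<sigma> < 1" using assms(2) by simp
  have "1 - real m * \<sigma> \<le> (1 - \<sigma>) ^ m" using Bernoulli_inequality[of "- \<sigma>" m] s by simp
  then have "(1 + \<sigma>) ^ m * (1 - real m * \<sigma>) \<le> (1 + \<sigma>) ^ m * (1 - \<sigma>) ^ m"
    using assms(1) by (intro mult_left_mono) auto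
  also have "\<dots> = (1 - \<sigma>\<^sup>2) ^ m"
    by (simp add: power_mult_distrib[symmetric] algebra_simps power2_eq_square)
  also have "\<dots> \<le> 1" using s assms(1) by (intro power_le_one) (auto simp: power_le_one)
  finally show ?thesis using assms(2) by (simp add: field_simps)
qed simp

text \<open>Origin of \<sigma>: two products of two perturbations and one product of three.\<close>

lemma compensated_step_factor_bound:
  fixes \<alpha> \<beta> \<gamma> \<epsilon> :: real
  assumes "\<bar>\<alpha>\<bar> \<le> \<epsilon>" "\<bar>\<beta>\<bar> \<le> \<epsilon>" "\<bar>\<gamma>\<bar> \<le> \<epsilon>"
  shows "\<bar>- \<alpha> * \<beta> - \<beta> * \<gamma> - \<alpha> * \<beta> * \<gamma>\<bar> \<le> 2 * \<epsilon>\<^sup>2 + \<epsilon> ^ 3"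
proof -
  have "\<bar>\<alpha> * \<beta>\<bar> \<le> \<epsilon> * \<epsilon>" "\<bar>\<beta> * \<gamma>\<bar> \<le> \<epsilon> * \<epsilon>" "\<bar>\<alpha> * \<beta> * \<gamma>\<bar> \<le> \<epsilon> * \<epsilon> * \<epsilon>"
    unfolding abs_mult using assms by (auto intro!: mult_mono)
  then show ?thesis by (simp add: power2_eq_square power3_eq_cube)
qed

lemma linear_recurrence_solution:
  fixes A :: "nat \<Rightarrow> 'a::comm_ring_1"
  assumes "A 0 = 0" and "\<And>i. i \<in> {1..n} \<Longrightarrow> A i = c i * A (i - 1) + d i"
  shows "m \<le> n \<Longrightarrow> A m = (\<Sum>k=1..m. (\<Prod>i=k+1..m. c i) * d k)"
proof (induction m)
  case (Suc m)
  have "A (Suc m) = c (Suc m) * A m + d (Suc m)" using assms(2)[of "Suc m"] Suc.prems by simp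
  also have "\<dots> = (\<Sum>k=1..m. c (Suc m) * ((\<Prod>i=k+1..m. c i) * d k)) + d (Suc m)"
    using Suc by (simp add: sum_distrib_left)
  \<comment> \<open>The new factor extends each old product; the term \<open>k = Suc m\<close>
    carries the empty product.\<close>
  also have "(\<Sum>k=1..m. c (Suc m) * ((\<Prod>i=k+1..m. c i) * d k)) =
      (\<Sum>k=1..m. (\<Prod>i=k+1..Suc m. c i) * d k)"
    by (intro sum.cong) (auto simp: algebra_simps)
  finally show ?case by simp
qed (use assms(1) in simp)

text \<open>With \<open>A = s0 + e0\<close> one has \<open>e0 = - \<gamma>0 * A\<close> and
  \<open>s0 = (1 + \<gamma>0) * A\<close>. Since \<open>t + v = s0 + x\<close>, the only defect of
  \<open>t + w\<close> is \<open>\<beta> * (e0 + v)\<close>, where \<open>e0\<close> and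
  \<open>v\<close> each already carry a perturbation.\<close>

lemma compensated_step:
  fixes \<alpha> \<beta> \<gamma>0 :: real
  assumes "t = (1 + \<alpha>) * (s0 + x)" "v = - \<alpha> * (s0 + x)" "w = (1 + \<beta>) * (e0 + v)"
    and "e0 = - \<gamma>0 * (s0 + e0)"
  shows "t + w = (1 - \<alpha> * \<beta> - \<beta> * \<gamma>0 - \<alpha> * \<beta> * \<gamma>0) * (s0 + e0) + (1 - \<alpha> * \<beta>) * x"
proof -
  define A where "A = s0 + e0"
  have e0: "e0 = - \<gamma>0 * A" using assms(4) by (simp add: A_def)
  have s0: "s0 = A + \<gamma>0 * A" using e0 by (simp add: A_def)
  show ?thesis
    unfolding assms(1-3) A_def[symmetric] unfolding e0 s0 by (simp add: algebra_simps)
qed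

lemma perturbed_sum_error:
  fixes \<theta> \<rho> x :: "nat \<Rightarrow> real"
  assumes \<theta>: "\<And>i. i \<in> {1..n} \<Longrightarrow> \<bar>\<theta> i\<bar> \<le> \<sigma>" and \<rho>: "\<And>i. i \<in> {1..n} \<Longrightarrow> \<bar>\<rho> i\<bar> \<le> \<tau>"
    and \<sigma>: "\<sigma> \<ge> 0" "real n * \<sigma> < 1"
  shows "\<bar>(\<Sum>k=1..n. (\<Prod>i=k+1..n. 1 + \<theta> i) * (1 - \<rho> k) * x k) - (\<Sum>k=1..n. x k)\<bar>
    \<le> \<tau> * (\<Sum>k=1..n. \<bar>x k\<bar>)
      + (\<Sum>k=1..n. (real n - real k) * \<sigma> / (1 - (real n - real k) * \<sigma>) * \<bar>x k\<bar>)
      + (\<Sum>k=1..n. (real n - real k) * \<sigma> * \<tau> / (1 - (real n - real k) * \<sigma>) * \<bar>x k\<bar>)"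
proof -
  have "\<bar>(\<Prod>i=k+1..n. 1 + \<theta> i) * (1 - \<rho> k) * x k - x k\<bar>
      \<le> \<tau> * \<bar>x k\<bar> + (real n - real k) * \<sigma> / (1 - (real n - real k) * \<sigma>) * \<bar>x k\<bar>
        + (real n - real k) * \<sigma> * \<tau> / (1 - (real n - real k) * \<sigma>) * \<bar>x k\<bar>"
    if k: "k \<in> {1..n}" for k
  proof -
    define P where "P = (\<Prod>i=k+1..n. 1 + \<theta> i)"
    define \<eta> where "\<eta> = (real n - real k) * \<sigma> / (1 - (real n - real k) * \<sigma>)"
    have nk: "real (n - k) = real n - real k" using k by (simp add: of_nat_diff)
    have "real (n - k) * \<sigma> \<le> real n * \<sigma>" using \<sigma> by (intro mult_right_mono) auto
    then have "real (n - k) * \<sigma> < 1" using \<sigma> by simp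
    from one_plus_power_minus_one_le[OF \<sigma>(1) this]
    have "(1 + \<sigma>) ^ (n - k) - 1 \<le> \<eta>" by (simp add: \<eta>_def nk)
    moreover have "\<bar>P - 1\<bar> \<le> (1 + \<sigma>) ^ (n - k) - 1"
      using prod_one_plus_minus_one_abs_le[of "{k+1..n}" \<theta> \<sigma>] \<theta> by (simp add: P_def)
    ultimately have P: "\<bar>P - 1\<bar> \<le> \<eta>" by simp
    have r: "\<bar>\<rho> k\<bar> \<le> \<tau>" using \<rho> k by simp
    \<comment> \<open>The three terms of this expansion give the three sums of the bound.\<close>
    have "\<bar>P * (1 - \<rho> k) * x k - x k\<bar> = \<bar>(P - 1) - \<rho> k - (P - 1) * \<rho> k\<bar> * \<bar>x k\<bar>"
      unfolding abs_mult[symmetric] by (simp add: algebra_simps)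
    also have "\<dots> \<le> (\<eta> + \<tau> + \<eta> * \<tau>) * \<bar>x k\<bar>"
    proof (rule mult_right_mono)
      have "\<bar>(P - 1) * \<rho> k\<bar> \<le> \<eta> * \<tau>" unfolding abs_mult using P r by (intro mult_mono) auto
      then show "\<bar>(P - 1) - \<rho> k - (P - 1) * \<rho> k\<bar> \<le> \<eta> + \<tau> + \<eta> * \<tau>" using P r by linarith
    qed simp
    finally show ?thesis by (simp add: P_def \<eta>_def algebra_simps)
  qed
  note term_error = this
  have "\<bar>(\<Sum>k=1..n. (\<Prod>i=k+1..n. 1 + \<theta> i) * (1 - \<rho> k) * x k) - (\<Sum>k=1..n. x k)\<bar>
     \<le> (\<Sum>k=1..n. \<bar>(\<Prod>i=k+1..n. 1 + \<theta> i) * (1 - \<rho> k) * x k - x k\<bar>)"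
    unfolding sum_subtractf[symmetric] by (rule sum_abs)
  also have "\<dots> \<le> (\<Sum>k=1..n. \<tau> * \<bar>x k\<bar>
        + (real n - real k) * \<sigma> / (1 - (real n - real k) * \<sigma>) * \<bar>x k\<bar>
        + (real n - real k) * \<sigma> * \<tau> / (1 - (real n - real k) * \<sigma>) * \<bar>x k\<bar>)"
    by (rule sum_mono) (rule term_error)
  finally show ?thesis by (simp add: sum.distrib sum_distrib_left)
qed

text \<open>The weights decrease in \<open>k\<close>, so the one at \<open>k = 1\<close> dominates.
  Keeping \<tau> as a parameter covers both weighted sums, the first with \<tau> equal to 1.\<close>

lemma weighted_sum_max_weight:
  fixes x :: "nat \<Rightarrow> real"
  assumes \<sigma>: "\<sigma> \<ge> 0" "real n * \<sigma> < 1" and \<tau>: "\<tau> \<ge> 0"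
  shows "(\<Sum>k=1..n. (real n - real k) * \<sigma> * \<tau> / (1 - (real n - real k) * \<sigma>) * \<bar>x k\<bar>)
    \<le> (real n - 1) * \<sigma> * \<tau> / (1 - (real n - 1) * \<sigma>) * (\<Sum>k=1..n. \<bar>x k\<bar>)"
  unfolding sum_distrib_left
proof (intro sum_mono mult_right_mono)
  fix k assume k: "k \<in> {1..n}"
  have "(real n - real k) * \<sigma> \<le> (real n - 1) * \<sigma>" "(real n - 1) * \<sigma> \<le> real n * \<sigma>"
    using \<sigma> k by (auto intro!: mult_right_mono)
  then show "(real n - real k) * \<sigma> * \<tau> / (1 - (real n - real k) * \<sigma>)
      \<le> (real n - 1) * \<sigma> * \<tau> / (1 - (real n - 1) * \<sigma>)"
    using \<sigma> \<tau> k by (intro frac_le mult_right_mono) auto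
qed simp

section \<open>Error of doubly compensated recursive summation\<close>

theorem mainTheorem4:
  fixes p n :: nat and Emin Emax :: int
    and fl :: "real \<Rightarrow> real"
    and x s e t v w :: "nat \<Rightarrow> real"
    and \<epsilon> \<sigma> \<tau> \<Omega> stilde :: real
  assumes p: "p \<ge> 1" and E: "Emin \<le> Emax"
    and rnd: "nearest_rounding (dekker p Emin Emax) fl"
    and n: "n \<ge> 1"
    and x: "\<forall>i\<in>{1..n}. x i \<in> dekker p Emin Emax"
    and init: "s 0 = 0" "e 0 = 0"
    and step1: "\<forall>i\<in>{1..n}. (t i, v i) = add6 fl (s (i - 1)) (x i)"
    and step2: "\<forall>i\<in>{1..n}. w i = fl (e (i - 1) + v i)"
    and step3: "\<forall>i\<in>{1..n}. (s i, e i) = add6 fl (t i) (w i)"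
    and Om: "\<Omega> = max_float p Emax"
    and no_overflow:
      "\<forall>i\<in>{1..n}. add6_no_overflow \<Omega> fl (s (i - 1)) (x i) \<and>
                   \<bar>e (i - 1) + v i\<bar> \<le> \<Omega> \<and>
                   add6_no_overflow \<Omega> fl (t i) (w i)"
    and eps: "\<epsilon> = unit_roundoff p"
    and sigma: "\<sigma> = 2 * \<epsilon>^2 + \<epsilon>^3"
    and tau: "\<tau> = \<epsilon>^2"
    and stilde: "stilde = (\<Sum>k=1..n. x k)"
  shows "(\<exists>\<alpha> \<beta> \<gamma> :: nat \<Rightarrow> real.
            \<gamma> 0 = 0 \<and>
            (\<forall>i\<in>{1..n}.
               \<bar>\<alpha> i\<bar> \<le> \<epsilon> \<and> \<bar>\<beta> i\<bar> \<le> \<epsilon> \<and> \<bar>\<gamma> i\<bar> \<le> \<epsilon> \<and>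
               t i = (1 + \<alpha> i) * (s (i - 1) + x i) \<and>
               v i = - \<alpha> i * (s (i - 1) + x i) \<and>
               w i = (1 + \<beta> i) * (e (i - 1) + v i) \<and>
               s i = (1 + \<gamma> i) * (t i + w i) \<and>
               e i = - \<gamma> i * (t i + w i) \<and>
               s i + e i =
                 (1 - \<alpha> i * \<beta> i - \<beta> i * \<gamma> (i - 1) - \<alpha> i * \<beta> i * \<gamma> (i - 1))
                   * (s (i - 1) + e (i - 1))
                 + (1 - \<alpha> i * \<beta> i) * x i) \<and>
            s n + e n =
              (\<Sum>k=1..n.
                 (\<Prod>i=k+1..n. 1 - \<alpha> i * \<beta> i - \<beta> i * \<gamma> (i - 1) - \<alpha> i * \<beta> i * \<gamma> (i - 1))
                   * (1 - \<alpha> k * \<beta> k) * x k))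
       \<and>
         (real n * \<sigma> < 1 \<longrightarrow>
            \<bar>s n + e n - stilde\<bar>
              \<le> \<tau> * (\<Sum>k=1..n. \<bar>x k\<bar>)
                + (\<Sum>k=1..n. (real n - real k) * \<sigma> / (1 - (real n - real k) * \<sigma>) * \<bar>x k\<bar>)
                + (\<Sum>k=1..n. (real n - real k) * \<sigma> * \<tau> / (1 - (real n - real k) * \<sigma>) * \<bar>x k\<bar>)
          \<and>
            \<tau> * (\<Sum>k=1..n. \<bar>x k\<bar>)
                + (\<Sum>k=1..n. (real n - real k) * \<sigma> / (1 - (real n - real k) * \<sigma>) * \<bar>x k\<bar>)
                + (\<Sum>k=1..n. (real n - real k) * \<sigma> * \<tau> / (1 - (real n - real k) * \<sigma>) * \<bar>x k\<bar>)
              \<le> \<tau> * (\<Sum>k=1..n. \<bar>x k\<bar>)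
                + (real n - 1) * \<sigma> / (1 - (real n - 1) * \<sigma>) * (\<Sum>k=1..n. \<bar>x k\<bar>)
                + (real n - 1) * \<sigma> * \<tau> / (1 - (real n - 1) * \<sigma>) * (\<Sum>k=1..n. \<bar>x k\<bar>)
          \<and>
            \<bar>s n - stilde\<bar>
              \<le> (1 + \<epsilon>) *
                  (\<tau> * (\<Sum>k=1..n. \<bar>x k\<bar>)
                   + (real n - 1) * \<sigma> / (1 - (real n - 1) * \<sigma>) * (\<Sum>k=1..n. \<bar>x k\<bar>)
                   + (real n - 1) * \<sigma> * \<tau> / (1 - (real n - 1) * \<sigma>) * (\<Sum>k=1..n. \<bar>x k\<bar>))
                + \<epsilon> * \<bar>\<Sum>k=1..n. x k\<bar>)"
proof -
  interpret dekker_rounding p Emin Emax fl using p E rnd by unfold_locales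
  \<comment> \<open>Membership of \<open>s i\<close> and \<open>e i\<close> in \<open>D\<close> is
    carried through the induction, because the next step adds to them.\<close>
  have steps: "(s i \<in> D \<and> e i \<in> D) \<and> (i \<ge> 1 \<longrightarrow> (\<exists>a b c. \<bar>a\<bar> \<le> \<epsilon> \<and> \<bar>b\<bar> \<le> \<epsilon> \<and> \<bar>c\<bar> \<le> \<epsilon> \<and>
      t i = (1 + a) * (s (i - 1) + x i) \<and> v i = - a * (s (i - 1) + x i) \<and>
      w i = (1 + b) * (e (i - 1) + v i) \<and>
      s i = (1 + c) * (t i + w i) \<and> e i = - c * (t i + w i)))"
    if "i \<le> n" for i
    using that
  proof (induction i)
    case 0
    then show ?case by (simp add: init)
  next
    case (Suc i)
    then have i: "Suc i \<in> {1..n}" and D: "s i \<in> D" "e i \<in> D" by auto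
    have no: "add6_no_overflow Om fl (s i) (x (Suc i))" "\<bar>e i + v (Suc i)\<bar> \<le> Om"
        "add6_no_overflow Om fl (t (Suc i)) (w (Suc i))"
      using no_overflow i Om by force+
    have xD: "x (Suc i) \<in> D" using x i by blast
    have st: "(t (Suc i), v (Suc i)) = add6 fl (s i) (x (Suc i))"
        "w (Suc i) = fl (e i + v (Suc i))"
        "(s (Suc i), e (Suc i)) = add6 fl (t (Suc i)) (w (Suc i))"
      using step1 step2 step3 i by force+
    note tv = add6_perturbation[OF D(1) xD no(1) st(1)]
    have wD: "w (Suc i) \<in> D" by (simp add: st)
    note wp = fl_add_perturbation[OF D(2) tv(2) no(2), folded st(2)]
    note se = add6_perturbation[OF tv(1) wD no(3) st(3)]
    show ?case using tv(3) wp se unfolding eps by auto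
  qed
  then have "\<forall>i. \<exists>a b c. i \<in> {1..n} \<longrightarrow> \<bar>a\<bar> \<le> \<epsilon> \<and> \<bar>b\<bar> \<le> \<epsilon> \<and> \<bar>c\<bar> \<le> \<epsilon> \<and>
      t i = (1 + a) * (s (i - 1) + x i) \<and> v i = - a * (s (i - 1) + x i) \<and>
      w i = (1 + b) * (e (i - 1) + v i) \<and>
      s i = (1 + c) * (t i + w i) \<and> e i = - c * (t i + w i)"
    by (metis atLeastAtMost_iff)
  then obtain \<alpha> \<beta> \<gamma>' where ex: "\<And>i. i \<in> {1..n} \<Longrightarrow>
      \<bar>\<alpha> i\<bar> \<le> \<epsilon> \<and> \<bar>\<beta> i\<bar> \<le> \<epsilon> \<and> \<bar>\<gamma>' i\<bar> \<le> \<epsilon> \<and>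
      t i = (1 + \<alpha> i) * (s (i - 1) + x i) \<and> v i = - \<alpha> i * (s (i - 1) + x i) \<and>
      w i = (1 + \<beta> i) * (e (i - 1) + v i) \<and>
      s i = (1 + \<gamma>' i) * (t i + w i) \<and> e i = - \<gamma>' i * (t i + w i)"
    by metis
  \<comment> \<open>The choice leaves the value at 0 unspecified; it is reset to the required
    one.\<close>
  define \<gamma> where "\<gamma> = \<gamma>'(0 := 0)"
  have \<gamma>0: "\<gamma> 0 = 0" by (simp add: \<gamma>_def)
  have pert: "\<bar>\<alpha> i\<bar> \<le> \<epsilon>" "\<bar>\<beta> i\<bar> \<le> \<epsilon>" "\<bar>\<gamma> i\<bar> \<le> \<epsilon>"
      "t i = (1 + \<alpha> i) * (s (i - 1) + x i)" "v i = - \<alpha> i * (s (i - 1) + x i)"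
      "w i = (1 + \<beta> i) * (e (i - 1) + v i)"
      "s i = (1 + \<gamma> i) * (t i + w i)" "e i = - \<gamma> i * (t i + w i)"
    if "i \<in> {1..n}" for i
    using ex[OF that] that by (auto simp: \<gamma>_def)
  have eps0: "\<epsilon> \<ge> 0" by (simp add: eps unit_roundoff_eq)
  have sum_se: "s i + e i = t i + w i" if "i \<in> {1..n}" for i
    unfolding pert(7,8)[OF that] by (simp add: algebra_simps)
  \<comment> \<open>At \<open>i = 0\<close> both sides vanish, so the recurrence also covers the
    first step.\<close>
  have e_rel: "e i = - \<gamma> i * (s i + e i)" if "i \<le> n" for i
    using that pert(8)[of i] sum_se[of i] init by (cases "i = 0") auto
  define \<theta> where "\<theta> = (\<lambda>i. - \<alpha> i * \<beta> i - \<beta> i * \<gamma> (i - 1) - \<alpha> i * \<beta> i * \<gamma> (i - 1))"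
  have \<theta>_eq: "1 - \<alpha> i * \<beta> i - \<beta> i * \<gamma> (i - 1) - \<alpha> i * \<beta> i * \<gamma> (i - 1) = 1 + \<theta> i" for i
    by (simp add: \<theta>_def)
  have recur: "s i + e i = (1 + \<theta> i) * (s (i - 1) + e (i - 1)) + (1 - \<alpha> i * \<beta> i) * x i"
    if i: "i \<in> {1..n}" for i
    using compensated_step[OF pert(4-6)[OF i] e_rel] i sum_se[OF i] \<theta>_eq[of i] by auto
  have closed: "s n + e n = (\<Sum>k=1..n. (\<Prod>i=k+1..n. 1 + \<theta> i) * (1 - \<alpha> k * \<beta> k) * x k)"
    using linear_recurrence_solution[of "\<lambda>i. s i + e i" n, OF _ recur order_refl] init
    by (simp add: mult.assoc)
  have \<theta>: "\<bar>\<theta> i\<bar> \<le> \<sigma>" if i: "i \<in> {1..n}" for i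
    unfolding \<theta>_def sigma
  proof (rule compensated_step_factor_bound)
    show "\<bar>\<gamma> (i - 1)\<bar> \<le> \<epsilon>" using pert(3)[of "i - 1"] i \<gamma>0 eps0 by (cases "i = 1") fastforce+
  qed (use pert i in auto)
  have \<rho>: "\<bar>\<alpha> i * \<beta> i\<bar> \<le> \<tau>" if i: "i \<in> {1..n}" for i
    unfolding abs_mult tau power2_eq_square using pert(1,2)[OF i] by (intro mult_mono) auto
  have \<sigma>0: "\<sigma> \<ge> 0" and \<tau>0: "\<tau> \<ge> 0" using eps0 by (auto simp: sigma tau)
  let ?X = "\<Sum>k=1..n. \<bar>x k\<bar>"
  let ?B1 = "\<tau> * ?X
      + (\<Sum>k=1..n. (real n - real k) * \<sigma> / (1 - (real n - real k) * \<sigma>) * \<bar>x k\<bar>)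
      + (\<Sum>k=1..n. (real n - real k) * \<sigma> * \<tau> / (1 - (real n - real k) * \<sigma>) * \<bar>x k\<bar>)"
  let ?B2 = "\<tau> * ?X + (real n - 1) * \<sigma> / (1 - (real n - 1) * \<sigma>) * ?X
      + (real n - 1) * \<sigma> * \<tau> / (1 - (real n - 1) * \<sigma>) * ?X"
  have bounds: "\<bar>s n + e n - stilde\<bar> \<le> ?B1 \<and> ?B1 \<le> ?B2 \<and>
      \<bar>s n - stilde\<bar> \<le> (1 + \<epsilon>) * ?B2 + \<epsilon> * \<bar>\<Sum>k=1..n. x k\<bar>"
    if small: "real n * \<sigma> < 1"
  proof -
    have 1: "\<bar>s n + e n - stilde\<bar> \<le> ?B1"
      unfolding closed stilde by (rule perturbed_sum_error[OF \<theta> \<rho> \<sigma>0 small])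
    have 2: "?B1 \<le> ?B2"
      using weighted_sum_max_weight[OF \<sigma>0 small, of 1 x]
        weighted_sum_max_weight[OF \<sigma>0 small \<tau>0, of x] by simp
    have nn: "n \<in> {1..n}" using n by simp
    have "s n = (1 + \<gamma> n) * (s n + e n)" using pert(7)[OF nn] unfolding sum_se[OF nn] .
    \<comment> \<open>Dropping \<open>e n\<close> amplifies the compensated error by
      \<open>1 + \<gamma> n\<close> and leaves \<open>\<gamma> n * stilde\<close>, the source of the
      final first-order term.\<close>
    then have "s n - stilde = (1 + \<gamma> n) * (s n + e n - stilde) + \<gamma> n * stilde"
      unfolding right_diff_distrib by (simp add: distrib_right)
    then have "\<bar>s n - stilde\<bar> \<le> \<bar>1 + \<gamma> n\<bar> * \<bar>s n + e n - stilde\<bar> + \<bar>\<gamma> n\<bar> * \<bar>stilde\<bar>"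
      by (metis abs_mult abs_triangle_ineq)
    also have "\<dots> \<le> (1 + \<epsilon>) * ?B2 + \<epsilon> * \<bar>stilde\<bar>"
      using pert(3)[OF nn] 1 2 by (intro add_mono mult_mono) auto
    finally show ?thesis using 1 2 by (simp only: stilde)
  qed
  show ?thesis
    by (intro conjI impI exI[of _ \<alpha>] exI[of _ \<beta>] exI[of _ \<gamma>] ballI)
       (use bounds in \<open>auto simp only: \<theta>_eq \<gamma>0 intro: pert recur closed\<close>)
qed

end
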